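(* There exists a conformal map $\psi$ on the unit disk $\mathbb{D}$ with $\psi(0)=0$ such that, with $F_\alpha=\{z\in\mathbb{D}:|\psi(z)|=\alpha\}$ for $\alpha>0$, the limit $$\mu:=\lim_{\alpha\to+\infty}\frac{d_{\mathbb{D}}(0,F_\alpha)}{\log\alpha}$$ exists (as a finite positive real number) and $\psi\in H^{\mu}(\mathbb{D})$.
   Context: A conformal map on $\mathbb{D}=\{z\in\mathbb{C}:|z|<1\}$ is an injective holomorphic function $\psi:\mathbb{D}\to\mathbb{C}$. Hyperbolic distance: for $z,w\in\mathbb{D}$, $d_{\mathbb{D}}(z,w)=\log\frac{1+\left|\frac{z-w}{1-z\bar w}\right|}{1-\left|\frac{z-w}{1-z\bar w}\right|}$; for a set $E\subset\mathbb{D}$, $d_{\mathbb{D}}(z,E)=\inf\{d_{\mathbb{D}}(z,w):w\in E\}$ (with $\inf\emptyset=+\infty$). Hardy space: for $0<p<+\infty$, $H^p(\mathbb{D})$ is the set of holomorphic $f$ on $\mathbb{D}$ with $\sup_{0<r<1}\int_0^{2\pi}|f(re^{i\theta})|^p\,d\theta<+\infty$. *)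

theory Defs
  imports "HOL-Complex_Analysis.Complex_Analysis"
begin

abbreviation unit_disk :: "complex set" where
  "unit_disk \<equiv> ball 0 1"

definition conformal_map :: "(complex \<Rightarrow> complex) \<Rightarrow> bool" where
  "conformal_map \<psi> \<longleftrightarrow> \<psi> holomorphic_on unit_disk \<and> inj_on \<psi> unit_disk"

definition hyp_dist :: "complex \<Rightarrow> complex \<Rightarrow> real" where
  "hyp_dist z w =
     ln ((1 + cmod ((z - w) / (1 - z * cnj w))) / (1 - cmod ((z - w) / (1 - z * cnj w))))"

(* Extended-real valued, so that the distance to the empty set is \<infinity>. *)
definition hyp_dist_set :: "complex \<Rightarrow> complex set \<Rightarrow> ereal" where
  "hyp_dist_set z E = (INF w\<in>E. ereal (hyp_dist z w))"

definition level_set :: "(complex \<Rightarrow> complex) \<Rightarrow> real \<Rightarrow> complex set" where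
  "level_set \<psi> \<alpha> = {z \<in> unit_disk. cmod (\<psi> z) = \<alpha>}"

(* Only meant for 0 < p. *)
definition hardy_space :: "real \<Rightarrow> (complex \<Rightarrow> complex) set" where
  "hardy_space p = {f. f holomorphic_on unit_disk \<and>
     (SUP r\<in>{0<..<1}. \<integral>\<^sup>+\<theta>\<in>{0..2*pi}. ennreal (cmod (f (of_real r * cis \<theta>)) powr p) \<partial>lborel) < \<infinity>}"

end

(* The witness is psi(z) = F(w) - F(200) with w = 200 / (1 - z) and F(w) = w / (log w)^2, and mu = 1.
   On the half-plane Re w > 100 one has Re F' > 0, so F is injective there (Noshiro-Warschawski).
   Moreover |F(w)| <= Re (w / log w), and the right-hand side is harmonic in z, so the mean value
   property bounds the circle means of |psi|. The factor (log w)^2 is what puts psi into H^1, yet it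
   does not change the limit 1 of d(0, F_alpha) / log alpha. *)
theory Submission
  imports Defs "HOL-Real_Asymp.Real_Asymp"
begin

section \<open>General complex analysis: an injectivity criterion and circle means\<close>

text \<open>If \<open>f a = f b\<close>, the mean value theorem along the segment, applied to
  \<open>f\<close> divided by \<open>b - a\<close>, yields a point where
  \<open>Re (f' u) = 0\<close>. Dividing by \<open>b - a\<close> cancels the direction of the
  segment, so that \<open>f' u\<close> appears without a complex factor.\<close>

lemma inj_on_Re_deriv_pos:
  fixes f :: "complex \<Rightarrow> complex"
  assumes "convex S"
    and der: "\<And>z. z \<in> S \<Longrightarrow> (f has_field_derivative f' z) (at z)"
    and pos: "\<And>z. z \<in> S \<Longrightarrow> Re (f' z) > 0"
  shows "inj_on f S"
proof (rule inj_onI, rule ccontr)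
  fix a b assume ab: "a \<in> S" "b \<in> S" "f a = f b" "a \<noteq> b"
  have seg: "closed_segment a b \<subseteq> S"
    using assms(1) ab by (simp add: closed_segment_subset)
  have "((\<lambda>z. f z / (b - a)) has_field_derivative f' u / (b - a)) (at u)"
    if "u \<in> closed_segment a b" for u
    using der[of u] seg that by (intro DERIV_cdivide) auto
  from complex_mvt_line[OF this] obtain u where u: "u \<in> closed_segment a b"
    "Re (f b / (b - a)) - Re (f a / (b - a)) = Re (f' u / (b - a) * (b - a))"
    by blast
  then have "Re (f' u) = 0" using ab by simp
  with pos[of u] u seg show False by auto
qed

text \<open>This is Cauchy's integral formula at the centre, written out in the angle: the speed of
  \<open>circlepath\<close> is \<open>2 * pi * \<i>\<close> times the point itself, which cancels
  the Cauchy kernel.\<close>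

lemma circle_mean_value:
  fixes f :: "complex \<Rightarrow> complex"
  assumes "f holomorphic_on ball 0 1" and r: "0 < r" "r < 1"
  shows "((\<lambda>\<theta>. f (of_real r * cis \<theta>)) has_integral 2 * of_real pi * f 0) {0..2*pi}"
proof -
  have "f holomorphic_on cball 0 r"
    using assms by (auto intro: holomorphic_on_subset)
  then have "((\<lambda>u. f u / (u - 0)) has_contour_integral (2 * of_real pi * \<i> * f 0)) (circlepath 0 r)"
    using r by (intro Cauchy_integral_circlepath)
      (auto intro: holomorphic_on_imp_continuous_on holomorphic_on_subset)
  then have "((\<lambda>x. f (circlepath 0 r x) / circlepath 0 r x * vector_derivative (circlepath 0 r) (at x))
      has_integral (2 * of_real pi * \<i> * f 0)) {0..1}"
    by (simp add: has_contour_integral)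
  moreover have "f (circlepath 0 r x) / circlepath 0 r x * vector_derivative (circlepath 0 r) (at x)
      = 2 * of_real pi * \<i> * f (of_real r * cis (2 * pi * x))" for x
  proof -
    have "circlepath 0 r x = of_real r * cis (2 * pi * x)"
      by (simp add: circlepath cis_conv_exp mult_ac)
    moreover have "vector_derivative (circlepath 0 r) (at x)
        = 2 * of_real pi * \<i> * (of_real r * cis (2 * pi * x))"
      by (simp add: vector_derivative_circlepath cis_conv_exp mult_ac)
    ultimately show ?thesis using r by simp
  qed
  ultimately have "((\<lambda>x. 2 * of_real pi * \<i> * f (of_real r * cis (2 * pi * x)))
      has_integral (2 * of_real pi * \<i> * f 0)) {0..1}"
    by simp
  then have "((\<lambda>x. f (of_real r * cis (2 * pi * x))) has_integral f 0) {0..1}"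
    by (auto dest: has_integral_mult_right[of _ _ _ "1 / (2 * of_real pi * \<i>)"])
  \<comment> \<open>\<open>circlepath\<close> is parametrized over \<open>{0..1}\<close>; the
    substitution of \<open>2 * pi * x\<close> by the angle rescales the interval and supplies the
    factor \<open>2 * pi\<close>.\<close>
  note stretched = has_integral_stretch_real[OF this, of "1 / (2*pi)"]
  have "(\<lambda>x. x / (1 / (2 * pi))) ` {0..1} = {0..2*pi}"
    using image_mult_atLeastAtMost[of "2*pi" 0 1] by (simp add: mult_ac)
  with stretched show ?thesis by (simp add: scaleR_conv_of_real)
qed

section \<open>The function w / (log w)^2 on the half-plane Re w > 100\<close>

text \<open>The expression is even in \<open>b\<close>, equals 1 at 0, and has derivative
  \<open>x * cos x\<close>, which is nonnegative up to \<open>pi / 2\<close>. It is the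
  trigonometric core of \<open>norm_log_damped_le\<close>.\<close>

lemma cos_plus_mult_sin_ge_one:
  fixes b :: real
  assumes "\<bar>b\<bar> \<le> pi / 2"
  shows "1 \<le> cos b + b * sin b"
proof -
  have "cos 0 + 0 * sin 0 \<le> cos \<bar>b\<bar> + \<bar>b\<bar> * sin \<bar>b\<bar>"
  proof (rule DERIV_nonneg_imp_nondecreasing[of 0 "\<bar>b\<bar>" "\<lambda>x. cos x + x * sin x"])
    fix x assume "0 \<le> x" "x \<le> \<bar>b\<bar>"
    then have "0 \<le> x * cos x" using assms by (intro mult_nonneg_nonneg cos_ge_zero) auto
    moreover have "((\<lambda>x. cos x + x * sin x) has_real_derivative x * cos x) (at x)"
      by (auto intro!: derivative_eq_intros)
    ultimately show "\<exists>y. ((\<lambda>x. cos x + x * sin x) has_real_derivative y) (at x) \<and> 0 \<le> y"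
      by blast
  qed auto
  then show ?thesis by (auto simp: abs_if split: if_splits)
qed

text \<open>Beyond \<open>Re w > 100\<close> the real part of \<open>Ln w\<close> is at least 4, large enough compared to
  \<open>\<bar>Im (Ln w)\<bar> < pi / 2\<close> for the derivative of \<open>log_damped\<close> to have positive real part.\<close>

definition log_damped :: "complex \<Rightarrow> complex" where
  "log_damped w = w / Ln w ^ 2"

lemma ln_100_ge: "4 \<le> ln (100::real)"
proof -
  have "exp (4::real) = exp 1 ^ 4" by (simp flip: exp_of_nat_mult)
  \<comment> \<open>Since e is at most 3, e^4 is at most 81, which is below 100.\<close>
  also have "\<dots> \<le> 3 ^ 4" using exp_le by (intro power_mono) auto
  finally show ?thesis by (simp add: ln_ge_iff)
qed

lemma Ln_half_plane:
  assumes "Re w > 100"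
  shows "Re (Ln w) \<ge> 4" "\<bar>Im (Ln w)\<bar> < pi / 2" "Ln w \<noteq> 0" "w \<noteq> 0" "w \<notin> \<real>\<^sub>\<le>\<^sub>0"
proof -
  have w: "cmod w > 100" using assms complex_Re_le_cmod[of w] by linarith
  then show "w \<noteq> 0" by auto
  then show re: "Re (Ln w) \<ge> 4"
    using order_trans[OF ln_100_ge ln_mono[of 100 "cmod w"]] w by simp
  then show "Ln w \<noteq> 0" by auto
  show "\<bar>Im (Ln w)\<bar> < pi / 2" using assms Re_Ln_pos_lt[OF \<open>w \<noteq> 0\<close>] by auto
  show "w \<notin> \<real>\<^sub>\<le>\<^sub>0" using assms by (auto simp: complex_nonpos_Reals_iff)
qed

lemma log_damped_deriv:
  assumes "Re w > 100"
  shows "(log_damped has_field_derivative (Ln w - 2) / Ln w ^ 3) (at w)"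
proof -
  note h = Ln_half_plane[OF assms]
  have "((\<lambda>w. w / Ln w ^ 2) has_field_derivative
      (1 * Ln w ^ 2 - w * (2 * Ln w * inverse w)) / (Ln w ^ 2 * Ln w ^ 2)) (at w)"
    using h by (intro DERIV_divide DERIV_ident)
      (auto intro!: derivative_eq_intros simp: field_simps)
  also have "(1 * Ln w ^ 2 - w * (2 * Ln w * inverse w)) / (Ln w ^ 2 * Ln w ^ 2) = (Ln w - 2) / Ln w ^ 3"
    using h by (simp add: power2_eq_square power3_eq_cube frac_eq_eq)
      (simp add: algebra_simps)
  finally show ?thesis unfolding log_damped_def [abs_def] .
qed

lemma Re_log_damped_deriv_pos:
  assumes "Re w > 100"
  shows "Re ((Ln w - 2) / Ln w ^ 3) > 0"
proof -
  define a b where "a = Re (Ln w)" and "b = Im (Ln w)"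
  have L: "Ln w = Complex a b" by (simp add: a_def b_def)
  have a: "a \<ge> 4" and "\<bar>b\<bar> < pi / 2"
    using Ln_half_plane[OF assms] by (auto simp: a_def b_def)
  then have "\<bar>b\<bar> \<le> 2" using pi_less_4 by linarith
  then have b2: "b\<^sup>2 \<le> 4" using abs_le_square_iff[of b 2] by simp
  have a2: "a\<^sup>2 \<ge> 16" using power_mono[OF a, of 2] by simp
  \<comment> \<open>The real part of a quotient has the sign of the real part of numerator times
    conjugate denominator. From \<open>a\<^sup>2 \<ge> 16\<close> and
    \<open>b\<^sup>2 \<le> 4\<close>, the critical factor \<open>a\<^sup>2 - 3 * b\<^sup>2\<close>
    is at least 4.\<close>
  have "Re ((Ln w - 2) * cnj (Ln w ^ 3)) =
      (a - 2) * (a * (a\<^sup>2 - 3 * b\<^sup>2)) + b\<^sup>2 * (3 * a\<^sup>2 - b\<^sup>2)"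
    unfolding L by (simp add: complex_eq_iff power2_eq_square power3_eq_cube algebra_simps)
  also have "\<dots> > 0"
    using a a2 b2 by (intro add_pos_nonneg mult_pos_pos mult_nonneg_nonneg) auto
  finally show ?thesis unfolding Re_complex_div_gt_0 .
qed

lemma log_damped_inj: "inj_on log_damped {w. Re w > 100}"
  by (rule inj_on_Re_deriv_pos[OF _ log_damped_deriv Re_log_damped_deriv_pos])
     (auto simp: convex_halfspace_Re_gt)

text \<open>Write Log w = a + ib. After multiplication by |Log w|^2 the left side is |w| and the
  right side is |w| (a cos b + b sin b). As a is at least 1 and cos b is nonnegative, the previous
  trigonometric inequality suffices.\<close>

lemma norm_log_damped_le:
  assumes "Re w > 100"
  shows "cmod (log_damped w) \<le> Re (w / Ln w)"
proof -
  define a b where "a = Re (Ln w)" and "b = Im (Ln w)"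
  note h = Ln_half_plane[OF assms, folded a_def b_def]
  have w: "w = of_real (cmod w) * cis b"
    using exp_eq_polar[of "Ln w"] h by (simp add: b_def)
  have "1 \<le> cos b + b * sin b" using h by (intro cos_plus_mult_sin_ge_one) auto
  also have "\<dots> \<le> a * cos b + b * sin b"
    using h mult_right_mono[of 1 a "cos b"] cos_ge_zero[of b] by auto
  finally have "cmod w * 1 \<le> cmod w * (a * cos b + b * sin b)"
    by (intro mult_left_mono) auto
  also have "\<dots> = Re w * a + Im w * b"
    by (subst (2 3) w) (simp add: algebra_simps)
  finally have "cmod w / cmod (Ln w) ^ 2 \<le> (Re w * a + Im w * b) / cmod (Ln w) ^ 2"
    by (intro divide_right_mono) auto
  also have "\<dots> = Re (w / Ln w)"
    by (simp add: Re_divide cmod_power2 a_def b_def)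
  finally show ?thesis by (simp add: log_damped_def norm_divide norm_power)
qed

section \<open>The conformal map on the disk and its Hardy class\<close>

text \<open>The map 1 / (1 - z) sends the disk into Re > 1/2, because |z| < 1 is equivalent to |1 -
  z|^2 < 2 Re (1 - z). The factor 200 moves this bound to 100.\<close>

lemma Re_half_plane_map_gt:
  assumes "cmod z < 1"
  shows "Re (200 / (1 - z)) > 100"
proof -
  have "(Re z)\<^sup>2 + (Im z)\<^sup>2 < 1"
    using assms by (simp flip: cmod_power2 add: power_less_one_iff abs_square_less_1)
  then have "(1 - Re z)\<^sup>2 + (Im z)\<^sup>2 < 2 * (1 - Re z)"
    by (simp add: power2_eq_square algebra_simps)
  moreover have "(1 - Re z)\<^sup>2 + (Im z)\<^sup>2 > 0"
    using assms complex_Re_le_cmod[of z] by (intro add_pos_nonneg) auto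
  ultimately show ?thesis by (simp add: Re_divide pos_less_divide_eq)
qed

definition example_map :: "complex \<Rightarrow> complex" where
  "example_map z = log_damped (200 / (1 - z)) - log_damped 200"

lemma example_map_holomorphic: "example_map holomorphic_on unit_disk"
proof -
  have "log_damped holomorphic_on {w. Re w > 100}"
    using log_damped_deriv by (auto simp: holomorphic_on_def field_differentiable_def
        intro: has_field_derivative_at_within)
  moreover have "(\<lambda>z. 200 / (1 - z)) holomorphic_on unit_disk"
    by (intro holomorphic_intros) auto
  ultimately have "log_damped \<circ> (\<lambda>z. 200 / (1 - z)) holomorphic_on unit_disk"
    using Re_half_plane_map_gt by (intro holomorphic_on_compose_gen[where t = "{w. Re w > 100}"]) auto
  then show ?thesis
    unfolding example_map_def [abs_def] o_def by (rule holomorphic_on_diff) simp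
qed

lemma conformal_example_map: "conformal_map example_map"
proof -
  have "inj_on example_map unit_disk"
  proof (rule inj_onI)
    fix x y assume xy: "x \<in> unit_disk" "y \<in> unit_disk" "example_map x = example_map y"
    have "log_damped (200 / (1 - x)) = log_damped (200 / (1 - y))"
      using xy(3) unfolding example_map_def by simp
    moreover have "200 / (1 - x) \<in> {w. Re w > 100}" "200 / (1 - y) \<in> {w. Re w > 100}"
      using Re_half_plane_map_gt[of x] Re_half_plane_map_gt[of y] xy by auto
    ultimately have "200 / (1 - x) = 200 / (1 - y)"
      by (rule inj_onD[OF log_damped_inj])
    moreover have "1 - x \<noteq> 0" "1 - y \<noteq> 0" using xy by auto
    ultimately show "x = y" by (simp add: frac_eq_eq)
  qed
  then show ?thesis by (simp add: conformal_map_def example_map_holomorphic)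
qed

lemma example_map_hardy: "example_map \<in> hardy_space 1"
proof -
  define C where "C = cmod (log_damped 200)"
  \<comment> \<open>The constant \<open>C\<close> absorbs the subtracted value
    \<open>log_damped 200\<close>, so \<open>Re h\<close> dominates the modulus of
    \<open>example_map\<close>. Its circle means all equal \<open>Re (h 0)\<close>, giving a bound
    independent of \<open>r\<close>.\<close>
  define h where "h z = (200 / (1 - z)) / Ln (200 / (1 - z)) + of_real C" for z
  have h_ge: "cmod (example_map z) \<le> Re (h z)" if "cmod z < 1" for z
    using norm_log_damped_le[OF Re_half_plane_map_gt[OF that]]
      norm_triangle_ineq4[of "log_damped (200 / (1 - z))" "log_damped 200"]
    by (simp add: example_map_def h_def C_def)
  have h_holo: "h holomorphic_on ball 0 1"
    unfolding h_def [abs_def]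
    using Ln_half_plane[OF Re_half_plane_map_gt] by (intro holomorphic_intros) auto
  have "(\<integral>\<^sup>+\<theta>\<in>{0..2*pi}. ennreal (cmod (example_map (of_real r * cis \<theta>)) powr 1) \<partial>lborel)
      \<le> ennreal (2 * pi * Re (h 0))" if r: "r \<in> {0<..<1}" for r
  proof -
    have inD: "cmod (of_real r * cis \<theta>) < 1" for \<theta>
      using r by (simp add: norm_mult)
    have "((\<lambda>\<theta>. Re (h (of_real r * cis \<theta>))) has_integral Re (2 * of_real pi * h 0)) {0..2*pi}"
      using circle_mean_value[OF h_holo, of r] r by (intro has_integral_Re) auto
    then have int: "((\<lambda>\<theta>. Re (h (of_real r * cis \<theta>))) has_integral 2 * pi * Re (h 0)) {0..2*pi}"
      by simp
    have "(\<integral>\<^sup>+\<theta>\<in>{0..2*pi}. ennreal (cmod (example_map (of_real r * cis \<theta>)) powr 1) \<partial>lborel)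
        \<le> (\<integral>\<^sup>+\<theta>. ennreal (indicator {0..2*pi} \<theta> * Re (h (of_real r * cis \<theta>))) \<partial>lborel)"
      using h_ge[OF inD] by (intro nn_integral_mono) (auto simp: indicator_def ennreal_leI)
    also have "\<dots> = ennreal (2 * pi * Re (h 0))"
      \<comment> \<open>Passing from \<open>has_integral\<close> to the nonnegative Lebesgue
        integral requires a nonnegative integrand; \<open>Re h\<close> is one because it dominates a
        norm.\<close>
      using h_ge[OF inD] norm_ge_zero order_trans
      by (intro nn_integral_has_integral_lebesgue[OF _ int]) blast
    finally show ?thesis .
  qed
  then have "(SUP r\<in>{0<..<1}. \<integral>\<^sup>+\<theta>\<in>{0..2*pi}.
      ennreal (cmod (example_map (of_real r * cis \<theta>)) powr 1) \<partial>lborel) \<le> ennreal (2 * pi * Re (h 0))"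
    by (rule SUP_least)
  also have "\<dots> < \<infinity>" by simp
  finally show ?thesis by (simp add: hardy_space_def example_map_holomorphic)
qed

section \<open>Hyperbolic distance to the level sets\<close>

lemma hyp_dist_0: "hyp_dist 0 z = ln ((1 + cmod z) / (1 - cmod z))"
  by (simp add: hyp_dist_def)

lemma hyp_dist_level_lower:
  assumes "\<alpha> > cmod (log_damped 200)"
  shows "ereal (ln ((\<alpha> - cmod (log_damped 200)) / 200)) \<le> hyp_dist_set 0 (level_set example_map \<alpha>)"
  unfolding hyp_dist_set_def
proof (rule INF_greatest)
  fix z assume "z \<in> level_set example_map \<alpha>"
  then have z: "cmod z < 1" and \<alpha>: "cmod (example_map z) = \<alpha>" by (auto simp: level_set_def)
  define w where "w = 200 / (1 - z)"
  note h = Ln_half_plane[OF Re_half_plane_map_gt[OF z], folded w_def]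
  have "1 \<le> cmod (Ln w)" using h(1) complex_Re_le_cmod[of "Ln w"] by linarith
  then have "cmod (log_damped w) \<le> cmod w / 1"
    unfolding log_damped_def norm_divide norm_power
    by (intro divide_left_mono one_le_power) auto
  moreover have "cmod w \<le> 200 / (1 - cmod z)"
    unfolding w_def norm_divide using z norm_triangle_ineq2[of 1 z]
    by (auto intro!: divide_left_mono mult_pos_pos)
  moreover have "\<alpha> \<le> cmod (log_damped w) + cmod (log_damped 200)"
    using norm_triangle_ineq4[of "log_damped w" "log_damped 200"] \<alpha> by (simp add: example_map_def w_def)
  ultimately have "(\<alpha> - cmod (log_damped 200)) / 200 \<le> 1 / (1 - cmod z)"
    by (simp add: field_simps)
  also have "\<dots> \<le> (1 + cmod z) / (1 - cmod z)"
    using z by (intro divide_right_mono) auto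
  finally show "ereal (ln ((\<alpha> - cmod (log_damped 200)) / 200)) \<le> ereal (hyp_dist 0 z)"
    using assms unfolding hyp_dist_0 ereal_less_eq by (intro ln_mono) auto
qed

lemma log_damped_of_real:
  assumes "t > 0"
  shows "log_damped (of_real t) = of_real (t / (ln t)\<^sup>2)"
  using assms by (simp add: log_damped_def Ln_of_real)

text \<open>One point of the level set suffices. On the radius \<open>z = 1 - 200 / t\<close> the
  map is real and continuous in \<open>t\<close> and starts at 0 for \<open>t = 200\<close>, so it
  takes the value \<alpha> for some \<open>t \<le> s\<close>.\<close>

lemma hyp_dist_level_upper:
  assumes s: "s \<ge> 200" and \<alpha>: "0 \<le> \<alpha>" "\<alpha> \<le> s / (ln s)\<^sup>2 - 200 / (ln 200)\<^sup>2"
  shows "hyp_dist_set 0 (level_set example_map \<alpha>) \<le> ereal (ln s)"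
proof -
  have "continuous_on {200..s} (\<lambda>t. t / (ln t)\<^sup>2 - 200 / (ln 200)\<^sup>2)"
    by (intro continuous_intros) auto
  then obtain t where t: "200 \<le> t" "t \<le> s" "t / (ln t)\<^sup>2 - 200 / (ln 200)\<^sup>2 = \<alpha>"
    using IVT'[of "\<lambda>t. t / (ln t)\<^sup>2 - 200 / (ln 200)\<^sup>2" 200 \<alpha> s] s \<alpha> by auto
  define z where "z = complex_of_real (1 - 200 / t)"
  have nz: "cmod z = 1 - 200 / t"
    unfolding z_def norm_of_real using t by (simp add: field_simps)
  have w: "200 / (1 - z) = of_real t" using t by (simp add: z_def)
  have "example_map z = of_real \<alpha>"
    unfolding example_map_def w using log_damped_of_real[of t] log_damped_of_real[of 200] t
    by auto
  then have "z \<in> level_set example_map \<alpha>"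
    using nz t \<alpha> by (simp add: level_set_def)
  then have "hyp_dist_set 0 (level_set example_map \<alpha>) \<le> ereal (hyp_dist 0 z)"
    unfolding hyp_dist_set_def by (rule INF_lower)
  also have "hyp_dist 0 z = ln (t / 100 - 1)"
    unfolding hyp_dist_0 nz using t by (simp add: field_simps)
  \<comment> \<open>From \<open>200 \<le> t \<le> s\<close>, the argument \<open>t / 100 - 1\<close>
    lies between 1 and \<open>s\<close>.\<close>
  also have "\<dots> \<le> ln s"
    using t by (intro ln_mono) auto
  finally show ?thesis by simp
qed

lemma example_map_limit:
  "((\<lambda>\<alpha>. hyp_dist_set 0 (level_set example_map \<alpha>) / ereal (ln \<alpha>)) \<longlongrightarrow> ereal 1) at_top"
proof -
  define C where "C = cmod (log_damped 200)"
  define D :: real where "D = 200 / (ln 200)\<^sup>2"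
  show ?thesis
  proof (rule tendsto_sandwich)
    have "eventually (\<lambda>\<alpha>. \<alpha> > C \<and> \<alpha> > 1) at_top"
      \<comment> \<open>The condition \<alpha> > 1 makes \<open>ln \<alpha>\<close> positive, so
        that dividing by it preserves the inequality.\<close>
      by (intro eventually_conj eventually_gt_at_top)
    then show "eventually (\<lambda>\<alpha>. ereal (ln ((\<alpha> - C) / 200) / ln \<alpha>)
        \<le> hyp_dist_set 0 (level_set example_map \<alpha>) / ereal (ln \<alpha>)) at_top"
    proof eventually_elim
      case (elim \<alpha>)
      then show ?case
        using ereal_divide_right_mono[OF hyp_dist_level_lower[of \<alpha>], of "ereal (ln \<alpha>)"]
        by (simp add: C_def)
    qed
    \<comment> \<open>\<open>log_damped\<close> exceeds \<open>\<alpha>\<close> at \<open>\<alpha> (ln \<alpha>)\<^sup>3\<close>; any power above 2 would do.\<close>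
    have "eventually (\<lambda>\<alpha>::real. \<alpha> * ln \<alpha> ^ 3 \<ge> 200) at_top" by real_asymp
    moreover have "eventually (\<lambda>\<alpha>::real. \<alpha> \<le> \<alpha> * ln \<alpha> ^ 3 / (ln (\<alpha> * ln \<alpha> ^ 3))\<^sup>2 - D) at_top"
      by real_asymp
    ultimately show "eventually (\<lambda>\<alpha>. hyp_dist_set 0 (level_set example_map \<alpha>) / ereal (ln \<alpha>)
        \<le> ereal (ln (\<alpha> * ln \<alpha> ^ 3) / ln \<alpha>)) at_top"
      using eventually_gt_at_top[of 1]
    proof eventually_elim
      case (elim \<alpha>)
      then show ?case
        using ereal_divide_right_mono[OF hyp_dist_level_upper[of "\<alpha> * ln \<alpha> ^ 3" \<alpha>], of "ereal (ln \<alpha>)"]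
        by (simp add: D_def)
    qed
    \<comment> \<open>The numerators of the two bounds differ from \<open>ln \<alpha>\<close> by a
      bounded term and by \<open>3 * ln (ln \<alpha>)\<close> respectively, for large \<alpha>; both
      are negligible against \<open>ln \<alpha>\<close>.\<close>
    show "((\<lambda>\<alpha>. ereal (ln ((\<alpha> - C) / 200) / ln \<alpha>)) \<longlongrightarrow> ereal 1) at_top"
      unfolding lim_ereal by real_asymp
    show "((\<lambda>\<alpha>. ereal (ln (\<alpha> * ln \<alpha> ^ 3) / ln \<alpha>)) \<longlongrightarrow> ereal 1) at_top"
      unfolding lim_ereal by real_asymp
  qed
qed

theorem mainTheorem6:
  "\<exists>\<psi>. conformal_map \<psi> \<and> \<psi> 0 = 0 \<and>
     (\<exists>\<mu>::real. 0 < \<mu> \<and>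
        ((\<lambda>\<alpha>::real. hyp_dist_set 0 (level_set \<psi> \<alpha>) / ereal (ln \<alpha>)) \<longlongrightarrow> ereal \<mu>) at_top \<and>
        \<psi> \<in> hardy_space \<mu>)"
  using conformal_example_map example_map_limit example_map_hardy
  by (intro exI[of _ example_map] exI[of _ 1] conjI) (auto simp: example_map_def)

end
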